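(* Let $\boldsymbol{k}=(k_1,\ldots,k_r)$ be an admissible index and let $s\in\mathbb{C}$. The series $$\sum_{i=1}^{r}\ \sum_{0<n_1<\cdots<n_r} \frac{1}{n_1^{k_1}\cdots n_r^{k_r}}\cdot \frac{1}{n_i^{s}} \prod_{\substack{1\le j\le r\\ j\ne i}} \frac{n_j}{ n_j-n_i }$$ (where $n_1,\ldots,n_r$ run over integers) converges absolutely if and only if $$\max_{1\leq j\leq r}\{r-2j+2-(k_j+\cdots+k_r)\}<\Re(s).$$
   Context: An index is a tuple $(k_1,\ldots,k_r)$ of positive integers with $r\ge 1$; it is admissible if $k_r\ge 2$. Absolute convergence of the displayed series means that for every $i\in\{1,\ldots,r\}$ the inner series over $0<n_1<\cdots<n_r$ converges absolutely, i.e. the sum of the absolute values of all terms indexed by $(i,n_1,\ldots,n_r)$ is finite. Empty products are $1$. *)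

theory Defs
  imports "HOL-Analysis.Analysis"
begin

(* A tuple indexed by 1, ..., r is a function on nat, of which only the values on {1..r}
   matter. *)
definition is_index :: "nat \<Rightarrow> (nat \<Rightarrow> nat) \<Rightarrow> bool" where
  "is_index r k \<longleftrightarrow> r \<ge> 1 \<and> (\<forall>j\<in>{1..r}. k j \<ge> 1)"

definition admissible :: "nat \<Rightarrow> (nat \<Rightarrow> nat) \<Rightarrow> bool" where
  "admissible r k \<longleftrightarrow> is_index r k \<and> k r \<ge> 2"

(* The summation tuples are extensional (undefined outside {1..r}), so that each tuple
   0 < n_1 < ... < n_r is represented by exactly one function. *)
definition increasing_tuples :: "nat \<Rightarrow> (nat \<Rightarrow> nat) set" where
  "increasing_tuples r =
     {n \<in> {1..r} \<rightarrow>\<^sub>E {0<..}. strict_mono_on {1..r} n}"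

definition series_term :: "nat \<Rightarrow> (nat \<Rightarrow> nat) \<Rightarrow> complex \<Rightarrow> nat \<Rightarrow> (nat \<Rightarrow> nat) \<Rightarrow> complex" where
  "series_term r k s i n =
     1 / (\<Prod>j\<in>{1..r}. of_nat (n j) ^ k j) * (1 / of_nat (n i) powr s) *
     (\<Prod>j\<in>{1..r} - {i}. of_nat (n j) / (of_nat (n j) - of_nat (n i)))"

definition series_converges_absolutely :: "nat \<Rightarrow> (nat \<Rightarrow> nat) \<Rightarrow> complex \<Rightarrow> bool" where
  "series_converges_absolutely r k s \<longleftrightarrow>
     (\<forall>i\<in>{1..r}. (\<lambda>n. norm (series_term r k s i n)) summable_on increasing_tuples r)"

end

theory Submission
  imports Defs
begin

text \<open>
  Write \<open>\<sigma>\<close> for the real part of \<open>s\<close>. The absolute value of the \<open>i\<close>-th term at \<open>n\<close> is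
  \<open>n\<^sub>i\<close> to the power \<open>-k\<^sub>i - \<sigma>\<close>, times the factors \<open>n\<^sub>j powr (1 - k\<^sub>j) / \<bar>n\<^sub>j - n\<^sub>i\<bar>\<close> for
  \<open>j \<noteq> i\<close>. The competing exponents in the criterion measure how these factors behave when
  \<open>n\<^sub>1, \<dots>, n\<^bsub>J-1\<^esub>\<close> stay bounded while \<open>n\<^sub>J, \<dots>, n\<^sub>r\<close> are all close to a large number \<open>m\<close>.
  For \<open>i \<ge> J\<close> such a term has order \<open>m powr (e\<^sub>J - 1 - \<sigma>)\<close> with \<open>e\<^sub>J = r - 2J + 2 - (k\<^sub>J + \<dots> + k\<^sub>r)\<close>.

  Necessity. Already for \<open>i = r\<close>, a single tuple of this shape for every \<open>m\<close>
  (\<open>norm_series_term_split_tuple_ge\<close>) makes the series dominate a multiple of the harmonic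
  series if \<open>\<sigma> \<le> e\<^sub>J\<close>.

  Sufficiency. Each singular factor is bounded by powers of \<open>n\<^sub>j\<close> and \<open>n\<^sub>i\<close> times a weight
  concentrated near \<open>n\<^sub>j = 0\<close> and \<open>n\<^sub>j = n\<^sub>i\<close>: by partial fractions for \<open>j < i\<close>, by comparing \<open>n\<^sub>j\<close>
  with \<open>n\<^sub>j - n\<^sub>i\<close> for \<open>j > i\<close>. At the cost of a small exponent \<open>d\<close>, the sum of
  that weight over \<open>n\<^sub>j\<close> is bounded independently of \<open>n\<^sub>i\<close>. What remains is a
  product of powers of the increasing numbers \<open>n\<^sub>1 < \<dots> < n\<^sub>r\<close>; by Abel summation of logarithms it
  is at most \<open>1\<close> as soon as all tail sums of its exponents are nonpositive
  (\<open>prod_powr_le_1_if_tails_nonpos\<close>). The tail sums are, up to multiples of \<open>d\<close>, the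
  differences \<open>e\<^sub>J - \<sigma>\<close> for \<open>J \<le> i\<close>, and for \<open>J > i\<close> they are at most \<open>-1\<close> by admissibility. Hence
  every term is dominated by \<open>n\<^sub>i powr (-1 - d)\<close> times a product of weights
  (\<open>norm_series_term_le_centred_product\<close>), which is summable even without the ordering of the
  \<open>n\<^sub>j\<close> (\<open>summable_centred_product\<close>).
\<close>

section \<open>Abel summation\<close>

text \<open>
  Abel summation writes the sum as \<open>x\<^sub>a\<close> times the full sum of \<open>c\<close> plus nonnegative increments
  of \<open>x\<close> times tails of \<open>c\<close>. Going down from \<open>J = b\<close>, the tail of the weighted sum is bounded by
  \<open>x\<^sub>J\<close> times the tail of \<open>c\<close>.
\<close>
lemma sum_weighted_nonpos_if_tails_nonpos:
  fixes c x :: "nat \<Rightarrow> real"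
  assumes "a \<le> b" "mono_on {a..b} x" "0 \<le> x a"
    and tails: "\<And>J. J \<in> {a..b} \<Longrightarrow> sum c {J..b} \<le> 0"
  shows "(\<Sum>j\<in>{a..b}. c j * x j) \<le> 0"
proof -
  have "(\<Sum>j\<in>{J..b}. c j * x j) \<le> x J * sum c {J..b}" if "J \<in> {a..b}" for J
  proof -
    from that have "J \<le> b" by simp
    then show ?thesis using that
    proof (induction J rule: inc_induct)
      case base
      then show ?case by (simp add: mult.commute)
    next
      case (step J)
      have x: "x J \<le> x (Suc J)"
        using assms(2) step by (auto intro: mono_onD)
      have "(\<Sum>j\<in>{J..b}. c j * x j) = c J * x J + (\<Sum>j\<in>{Suc J..b}. c j * x j)"
        using step by (simp add: sum.atLeast_Suc_atMost)
      also have "\<dots> \<le> c J * x J + x (Suc J) * sum c {Suc J..b}"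
        using step by simp
      also have "\<dots> \<le> c J * x J + x J * sum c {Suc J..b}"
        using x tails[of "Suc J"] step by (intro add_left_mono mult_right_mono_neg) auto
      also have "\<dots> = x J * sum c {J..b}"
        using step by (simp add: sum.atLeast_Suc_atMost algebra_simps)
      finally show ?case .
    qed
  qed
  from this[of a] have "(\<Sum>j\<in>{a..b}. c j * x j) \<le> x a * sum c {a..b}"
    using assms(1) by simp
  also have "\<dots> \<le> 0"
    using tails[of a] assms by (intro mult_nonneg_nonpos) auto
  finally show ?thesis .
qed

text \<open>The exponential form: the weights are the logarithms of the \<open>x\<^sub>j\<close>.\<close>
lemma prod_powr_le_1_if_tails_nonpos:
  fixes c x :: "nat \<Rightarrow> real"
  assumes "a \<le> b" "mono_on {a..b} x" "1 \<le> x a"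
    and "\<And>J. J \<in> {a..b} \<Longrightarrow> sum c {J..b} \<le> 0"
  shows "(\<Prod>j\<in>{a..b}. x j powr c j) \<le> 1"
proof -
  have pos: "0 < x j" if "j \<in> {a..b}" for j
    using mono_onD[OF assms(2), of a j] assms(1,3) that by auto
  have "(\<Prod>j\<in>{a..b}. x j powr c j) = exp (\<Sum>j\<in>{a..b}. c j * ln (x j))"
    unfolding exp_sum[OF finite_atLeastAtMost]
  proof (rule prod.cong[OF refl])
    fix j assume "j \<in> {a..b}"
    then show "x j powr c j = exp (c j * ln (x j))"
      using pos[of j] by (simp add: powr_def)
  qed
  also have "\<dots> \<le> exp 0"
    using assms pos
    by (subst exp_le_cancel_iff, intro sum_weighted_nonpos_if_tails_nonpos)
       (auto intro!: mono_onI ln_mono dest: mono_onD)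
  finally show ?thesis by simp
qed

section \<open>The weight of a single variable\<close>

text \<open>
  For \<open>n = m\<close> the second summand is \<open>0\<close> because \<open>0 powr a = 0\<close>, so the diagonal needs no special
  treatment when the kernel is summed over \<open>n\<close>.
\<close>
definition kernel :: "real \<Rightarrow> nat \<Rightarrow> nat \<Rightarrow> real" where
  "kernel d m n = real n powr (-1 - d) + \<bar>real n - real m\<bar> powr (-1 - d)"

lemma kernel_nonneg: "0 \<le> kernel d m n"
  by (simp add: kernel_def)

text \<open>
  Partial fractions, \<open>1 / (n * (m - n)) = (1 / n + 1 / (m - n)) / m\<close>. The two fractions would
  only be summable up to a logarithm of \<open>m\<close>; the factor \<open>m powr d\<close> pays for making them
  summable.
\<close>
lemma factor_le_kernel_below:
  assumes "0 < n" "n < m" "0 \<le> d"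
  shows "real n powr (1 - a) / \<bar>real n - real m\<bar> \<le>
    real n powr (2 - a) * real m powr (d - 1) * kernel d m n"
proof -
  define x where "x = real n"
  define M where "M = real m"
  have pos: "0 < x" "x < M" using assms by (auto simp: x_def M_def)
  have *: "1 / y \<le> M powr d * y powr (-1 - d)" if "0 < y" "y \<le> M" for y
  proof -
    have "1 / y = y powr d * y powr (-1 - d)"
      using that by (simp add: powr_add[symmetric] powr_minus_divide)
    also have "\<dots> \<le> M powr d * y powr (-1 - d)"
      using that assms by (intro mult_right_mono powr_mono2) auto
    finally show ?thesis .
  qed
  have "x powr (1 - a) / (M - x) = x powr (2 - a) / M * (1 / x + 1 / (M - x))"
  proof -
    have "x powr (2 - a) = x powr (1 - a) * x"
      using pos powr_add[of x "1 - a" 1] by simp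
    then show ?thesis using pos by (simp add: field_simps)
  qed
  also have "\<dots> \<le> x powr (2 - a) / M * (M powr d * x powr (-1 - d) + M powr d * (M - x) powr (-1 - d))"
    using pos by (intro mult_left_mono add_mono *) auto
  also have "\<dots> = x powr (2 - a) * M powr (d - 1) * (x powr (-1 - d) + (M - x) powr (-1 - d))"
    using pos by (simp add: powr_diff field_simps)
  finally show ?thesis
    using pos by (simp add: kernel_def x_def[symmetric] M_def[symmetric] abs_minus_commute[of x M])
qed

text \<open>
  Above the pole the numerator \<open>n powr (-d)\<close> is at most \<open>(n - m) powr (-d)\<close>, which makes
  the simple pole summable at infinity.
\<close>
lemma factor_le_kernel_above:
  assumes "0 < m" "m < n" "0 \<le> d"
  shows "real n powr (1 - a) / \<bar>real n - real m\<bar> \<le> real n powr (1 - a + d) * kernel d m n"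
proof -
  define x where "x = real n"
  define y where "y = real n - real m"
  have pos: "0 < y" "y \<le> x" using assms by (auto simp: x_def y_def)
  have "x powr (1 - a) / y = x powr (1 - a + d) * (x powr (-d) * y powr -1)"
    using pos by (simp add: powr_add[symmetric] powr_minus_divide powr_diff powr_add)
  also have "\<dots> \<le> x powr (1 - a + d) * (y powr (-d) * y powr -1)"
    using pos assms by (intro mult_left_mono mult_right_mono powr_mono2') auto
  also have "\<dots> = x powr (1 - a + d) * y powr (-1 - d)"
  proof -
    have "-1 - d = -d + -1" by simp
    then show ?thesis by (simp only: powr_add)
  qed
  also have "\<dots> \<le> x powr (1 - a + d) * (x powr (-1 - d) + y powr (-1 - d))"
    by (intro mult_left_mono) auto
  finally show ?thesis
    using pos by (simp add: kernel_def x_def y_def)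
qed

lemma sum_kernel_bounded:
  assumes "0 < d"
  obtains G where "\<And>m A. finite A \<Longrightarrow> (\<Sum>n\<in>A. kernel d m n) \<le> G"
proof -
  define f where "f = (\<lambda>n. real n powr (-1 - d))"
  have summ: "summable f"
    using assms by (simp add: f_def summable_real_powr_iff)
  have reindexed: "(\<Sum>n\<in>A. f (p n)) \<le> suminf f" if "finite A" "inj_on p A" for A and p :: "nat \<Rightarrow> nat"
  proof -
    have "(\<Sum>n\<in>A. f (p n)) = sum f (p ` A)"
      using that by (simp add: sum.reindex)
    also have "\<dots> \<le> suminf f"
      using summ that by (intro sum_le_suminf) (auto simp: f_def)
    finally show ?thesis .
  qed
  have "(\<Sum>n\<in>A. kernel d m n) \<le> 3 * suminf f" if A: "finite A" for m and A :: "nat set"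
  proof -
    have "kernel d m n = f n + f (nat \<bar>int n - int m\<bar>)" for n
      by (simp add: kernel_def f_def)
    then have "(\<Sum>n\<in>A. kernel d m n) = sum f A + (\<Sum>n\<in>A. f (nat \<bar>int n - int m\<bar>))"
      by (simp add: sum.distrib)
    also have "(\<Sum>n\<in>A. f (nat \<bar>int n - int m\<bar>)) =
        (\<Sum>n\<in>A \<inter> {..<m}. f (nat \<bar>int n - int m\<bar>)) + (\<Sum>n\<in>A - {..<m}. f (nat \<bar>int n - int m\<bar>))"
      using A by (metis sum.Int_Diff)
    also have "sum f A + \<dots> \<le> suminf f + (suminf f + suminf f)"
      using A reindexed[of A "\<lambda>n. n"]
      by (intro add_mono reindexed) (auto simp: inj_on_def)
    finally show ?thesis by simp
  qed
  then show thesis using that by blast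
qed

section \<open>Summing the dominating series\<close>

text \<open>
  For a fixed value \<open>m\<close> of the coordinate \<open>n\<^sub>i\<close> the summand is a genuine product over the
  coordinates, the \<open>i\<close>-th factor being \<open>h\<close> restricted to \<open>{m}\<close>; then the sum over all functions
  factorises.
\<close>
lemma sum_PiE_centred_product:
  fixes h :: "'b \<Rightarrow> real" and g :: "'b \<Rightarrow> 'b \<Rightarrow> real"
  assumes "finite I" "i \<in> I" "finite B"
  shows "(\<Sum>n\<in>PiE I (\<lambda>_. B). h (n i) * (\<Prod>j\<in>I - {i}. g (n i) (n j))) =
    (\<Sum>m\<in>B. h m * (\<Sum>x\<in>B. g m x) ^ (card I - 1))"
proof -
  have "(\<Sum>n\<in>PiE I (\<lambda>_. B). h (n i) * (\<Prod>j\<in>I - {i}. g (n i) (n j))) =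
      (\<Sum>n\<in>PiE I (\<lambda>_. B). \<Sum>m\<in>B. if m = n i then h m * (\<Prod>j\<in>I - {i}. g m (n j)) else 0)"
    using assms by (intro sum.cong refl, subst sum.delta) auto
  also have "\<dots> = (\<Sum>n\<in>PiE I (\<lambda>_. B). \<Sum>m\<in>B. \<Prod>j\<in>I.
      if j = i then (if n j = m then h m else 0) else g m (n j))"
    using assms by (intro sum.cong refl) (auto simp: prod.remove intro!: prod.cong)
  also have "\<dots> = (\<Sum>m\<in>B. \<Prod>j\<in>I. \<Sum>x\<in>B. if j = i then (if x = m then h m else 0) else g m x)"
    using assms by (subst sum.swap, subst prod_sum_PiE) auto
  also have "\<dots> = (\<Sum>m\<in>B. h m * (\<Sum>x\<in>B. g m x) ^ (card I - 1))"
    using assms by (intro sum.cong refl) (simp add: prod.remove[of I i])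
  finally show ?thesis .
qed

text \<open>
  The summands are nonnegative, so one may forget the ordering of the coordinates and sum over a
  full box. Each coordinate other than \<open>n\<^sub>i\<close> then contributes at most a constant.
\<close>
lemma summable_centred_product:
  assumes "0 < d" "i \<in> {1..r}"
  shows "(\<lambda>n. real (n i) powr (-1 - d) * (\<Prod>j\<in>{1..r} - {i}. kernel d (n i) (n j)))
    summable_on increasing_tuples r"
proof -
  define T where "T = (\<lambda>n. real (n i) powr (-1 - d) * (\<Prod>j\<in>{1..r} - {i}. kernel d (n i) (n j)))"
  obtain G where G: "\<And>m A. finite A \<Longrightarrow> (\<Sum>n\<in>A. kernel d m n) \<le> G"
    using sum_kernel_bounded[OF assms(1)] by blast
  have G0: "0 \<le> G" using G[of "{}"] by simp
  have T0: "0 \<le> T n" for n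
    by (auto simp: T_def kernel_nonneg intro!: mult_nonneg_nonneg prod_nonneg)
  have summ: "summable (\<lambda>n. real n powr (-1 - d))"
    using assms by (simp add: summable_real_powr_iff)
  have "sum T F \<le> (\<Sum>n. real n powr (-1 - d)) * G ^ (r - 1)"
    if F: "finite F" "F \<subseteq> increasing_tuples r" for F
  proof -
    define B where "B = (\<Union>n\<in>F. n ` {1..r})"
    have B: "finite B" using F by (auto simp: B_def)
    have "F \<subseteq> PiE {1..r} (\<lambda>_. B)"
    proof
      fix n assume "n \<in> F"
      moreover from this F have "n \<in> extensional {1..r}"
        by (auto simp: increasing_tuples_def PiE_def)
      ultimately show "n \<in> PiE {1..r} (\<lambda>_. B)"
        unfolding PiE_def by (auto simp: B_def)
    qed
    then have "sum T F \<le> sum T (PiE {1..r} (\<lambda>_. B))"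
      using B T0 by (intro sum_mono2) (auto intro!: finite_PiE)
    also have "\<dots> = (\<Sum>m\<in>B. real m powr (-1 - d) * (\<Sum>x\<in>B. kernel d m x) ^ (r - 1))"
      unfolding T_def using sum_PiE_centred_product[of "{1..r}" i B "\<lambda>m. real m powr (-1 - d)" "kernel d"] assms B
      by simp
    also have "\<dots> \<le> (\<Sum>m\<in>B. real m powr (-1 - d) * G ^ (r - 1))"
      using B G by (intro sum_mono mult_left_mono power_mono sum_nonneg) (auto simp: kernel_nonneg)
    also have "\<dots> \<le> (\<Sum>n. real n powr (-1 - d)) * G ^ (r - 1)"
      unfolding sum_distrib_right[symmetric]
      using summ B G0 by (intro mult_right_mono sum_le_suminf) auto
    finally show ?thesis .
  qed
  then have "T summable_on increasing_tuples r"
    using T0 by (intro nonneg_bounded_partial_sums_imp_summable_on[where C = "(\<Sum>n. real n powr (-1 - d)) * G ^ (r - 1)"])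
       (auto intro!: eventually_finite_subsets_at_top_weakI)
  then show ?thesis by (simp add: T_def)
qed

section \<open>The absolute value of a term\<close>

lemma increasing_tuples_pos: "n \<in> increasing_tuples r \<Longrightarrow> j \<in> {1..r} \<Longrightarrow> 0 < n j"
  by (auto simp: increasing_tuples_def)

lemma increasing_tuples_less:
  "n \<in> increasing_tuples r \<Longrightarrow> a \<in> {1..r} \<Longrightarrow> b \<in> {1..r} \<Longrightarrow> a < b \<Longrightarrow> n a < n b"
  using strict_mono_onD[of "{1..r}" n a b] by (simp add: increasing_tuples_def)

lemma norm_series_term:
  assumes n: "n \<in> increasing_tuples r" and i: "i \<in> {1..r}"
  shows "norm (series_term r k s i n) = real (n i) powr (- real (k i) - Re s) *
    (\<Prod>j\<in>{1..r} - {i}. real (n j) powr (1 - real (k j)) / \<bar>real (n j) - real (n i)\<bar>)"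
proof -
  have pos: "0 < real (n j)" if "j \<in> {1..r}" for j
    using increasing_tuples_pos[OF n that] by simp
  have dist: "norm (of_nat a - of_nat b :: complex) = \<bar>real a - real b\<bar>" for a b
    by (metis norm_of_real of_real_diff of_real_of_nat_eq real_norm_def)
  have "norm (series_term r k s i n) = 1 / (\<Prod>j\<in>{1..r}. real (n j) ^ k j) * (1 / real (n i) powr Re s) *
      (\<Prod>j\<in>{1..r} - {i}. real (n j) / \<bar>real (n j) - real (n i)\<bar>)"
    using pos[OF i]
    by (simp add: series_term_def norm_mult norm_divide norm_power prod_norm[symmetric]
        dist norm_powr_real_powr)
  also have "(\<Prod>j\<in>{1..r}. real (n j) ^ k j) =
      real (n i) powr real (k i) * (\<Prod>j\<in>{1..r} - {i}. real (n j) powr real (k j))"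
    using i pos by (subst prod.remove[of _ i]) (auto simp: powr_realpow intro!: prod.cong)
  also have "1 / \<dots> * (1 / real (n i) powr Re s) *
      (\<Prod>j\<in>{1..r} - {i}. real (n j) / \<bar>real (n j) - real (n i)\<bar>) =
    real (n i) powr (- real (k i) - Re s) *
    ((\<Prod>j\<in>{1..r} - {i}. real (n j) / \<bar>real (n j) - real (n i)\<bar>) /
     (\<Prod>j\<in>{1..r} - {i}. real (n j) powr real (k j)))"
    by (simp add: powr_diff powr_minus field_simps)
  also have "(\<Prod>j\<in>{1..r} - {i}. real (n j) / \<bar>real (n j) - real (n i)\<bar>) /
     (\<Prod>j\<in>{1..r} - {i}. real (n j) powr real (k j)) =
     (\<Prod>j\<in>{1..r} - {i}. real (n j) powr (1 - real (k j)) / \<bar>real (n j) - real (n i)\<bar>)"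
    unfolding prod_dividef[symmetric] using pos
    by (intro prod.cong refl) (auto simp: powr_diff)
  finally show ?thesis .
qed

section \<open>The upper bound\<close>

definition tail_exponent :: "nat \<Rightarrow> (nat \<Rightarrow> nat) \<Rightarrow> nat \<Rightarrow> real" where
  "tail_exponent r k j = real r - 2 * real j + 2 - (\<Sum>l\<in>{j..r}. real (k l))"

text \<open>
  After the kernels are split off, the exponents of the \<open>n\<^sub>j\<close> add up from \<open>J \<le> i\<close> to \<open>r\<close> to
  \<open>tail_exponent r k J + d * r - \<sigma>\<close>, where \<open>\<sigma>\<close> is the real part of \<open>s\<close>. Beyond \<open>i\<close> they add up
  to at most \<open>-1 + d * r\<close>, since \<open>k\<^sub>r \<ge> 2\<close>. So Abel summation bounds the remaining product
  of powers by \<open>1\<close>.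
\<close>
lemma norm_series_term_le_centred_product:
  assumes adm: "admissible r k" and i: "i \<in> {1..r}" and n: "n \<in> increasing_tuples r"
    and d: "0 < d" "d * real r \<le> 1"
    and tail: "\<And>J. J \<in> {1..r} \<Longrightarrow> tail_exponent r k J + d * real r \<le> Re s"
  shows "norm (series_term r k s i n) \<le>
    real (n i) powr (-1 - d) * (\<Prod>j\<in>{1..r} - {i}. kernel d (n i) (n j))"
proof -
  \<comment> \<open>\<open>e\<close> collects the exponents left over by the two kernel estimates. At \<open>i\<close>, the value of \<open>c\<close>
    is the exponent of \<open>n\<^sub>i\<close> after the summable power \<open>-1 - d\<close> has been set aside; the \<open>i - 1\<close>
    variables below \<open>n\<^sub>i\<close> each contribute \<open>d - 1\<close> to it.\<close>
  define e where "e = (\<lambda>j. if j < i then 2 - real (k j) else 1 - real (k j) + d)"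
  define c where "c = e(i := 1 + d - real (k i) - Re s - (real i - 1) * (1 - d))"
  define K where "K = (\<Prod>j\<in>{1..r} - {i}. kernel d (n i) (n j))"
  have pos: "0 < n j" if "j \<in> {1..r}" for j
    using increasing_tuples_pos[OF n that] .
  have split: "{1..r} - {i} = {1..<i} \<union> {i<..r}" using i by auto
  have K0: "0 \<le> K" by (auto simp: K_def kernel_nonneg intro!: prod_nonneg)
  have "(\<Prod>j\<in>{1..r} - {i}. real (n j) powr (1 - real (k j)) / \<bar>real (n j) - real (n i)\<bar>) \<le>
      (\<Prod>j\<in>{1..r} - {i}. real (n j) powr e j * (if j < i then real (n i) powr (d - 1) else 1) *
        kernel d (n i) (n j))"
  proof (intro prod_mono conjI)
    fix j assume j: "j \<in> {1..r} - {i}"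
    show "real (n j) powr (1 - real (k j)) / \<bar>real (n j) - real (n i)\<bar> \<le>
      real (n j) powr e j * (if j < i then real (n i) powr (d - 1) else 1) * kernel d (n i) (n j)"
    proof (cases "j < i")
      case True
      then show ?thesis
        using factor_le_kernel_below[of "n j" "n i" d "real (k j)"] pos j d i
          increasing_tuples_less[OF n, of j i] by (simp add: e_def)
    next
      case False
      then show ?thesis
        using factor_le_kernel_above[of "n i" "n j" d "real (k j)"] pos j d i
          increasing_tuples_less[OF n, of i j] by (simp add: e_def)
    qed
  qed auto
  also have "\<dots> = (\<Prod>j\<in>{1..r} - {i}. real (n j) powr e j) *
      (\<Prod>j\<in>{1..r} - {i}. if j < i then real (n i) powr (d - 1) else 1) * K"
    by (simp add: prod.distrib K_def)
  also have "(\<Prod>j\<in>{1..r} - {i}. if j < i then real (n i) powr (d - 1) else 1) =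
      real (n i) powr ((real i - 1) * (d - 1))"
  proof -
    have "(\<Prod>j\<in>{1..r} - {i}. if j < i then real (n i) powr (d - 1) else 1) =
        (\<Prod>j\<in>{1..<i}. real (n i) powr (d - 1))"
      unfolding split by (subst prod.union_disjoint) auto
    also have "\<dots> = real (n i) powr ((real i - 1) * (d - 1))"
      using i pos[OF i] by (simp add: powr_power of_nat_diff mult.commute)
    finally show ?thesis .
  qed
  finally have "norm (series_term r k s i n) \<le> real (n i) powr (- real (k i) - Re s) *
      ((\<Prod>j\<in>{1..r} - {i}. real (n j) powr e j) * real (n i) powr ((real i - 1) * (d - 1)) * K)"
    unfolding norm_series_term[OF n i] by (intro mult_left_mono) auto
  also have "\<dots> = real (n i) powr (-1 - d) * K *
      (real (n i) powr c i * (\<Prod>j\<in>{1..r} - {i}. real (n j) powr e j))"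
  proof -
    have "real (n i) powr (- real (k i) - Re s) * real (n i) powr ((real i - 1) * (d - 1)) =
        real (n i) powr (-1 - d) * real (n i) powr c i"
      unfolding powr_add[symmetric] by (rule arg_cong[where f = "\<lambda>t. real (n i) powr t"]) (simp add: c_def algebra_simps)
    then show ?thesis by (metis (no_types, lifting) mult.assoc mult.commute)
  qed
  also have "real (n i) powr c i * (\<Prod>j\<in>{1..r} - {i}. real (n j) powr e j) = (\<Prod>j\<in>{1..r}. real (n j) powr c j)"
    using i by (subst prod.remove[of "{1..r}" i]) (auto simp: c_def intro!: prod.cong)
  also have "\<dots> \<le> 1"
  proof (rule prod_powr_le_1_if_tails_nonpos)
    show "1 \<le> r" using i by simp
    show "mono_on {1..r} (\<lambda>j. real (n j))"
      using increasing_tuples_less[OF n] by (auto intro!: mono_onI simp: le_less)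
    show "1 \<le> real (n 1)" using pos[of 1] i by simp
  next
    fix J assume J: "J \<in> {1..r}"
    show "sum c {J..r} \<le> 0"
    proof (cases "J \<le> i")
      case False
      have "sum c {J..r} = (\<Sum>j\<in>{J..r}. 1 - real (k j) + d)"
        using False by (intro sum.cong) (auto simp: c_def e_def)
      also have "\<dots> = (\<Sum>j\<in>{J..r}. 1 - real (k j)) + real (card {J..r}) * d"
        by (simp add: sum.distrib)
      also have "(\<Sum>j\<in>{J..r}. 1 - real (k j)) \<le> (\<Sum>j\<in>{J..r}. if j = r then -1 else 0)"
        using adm J by (intro sum_mono) (auto simp: admissible_def is_index_def)
      also have "\<dots> = -1" using J by simp
      also have "real (card {J..r}) * d \<le> real r * d"
        using d J by (intro mult_right_mono) auto
      finally show ?thesis using d by (simp add: mult.commute)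
    next
      case True
      have "{J..r} = {J..i} \<union> {i<..r}" using True i by auto
      then have "sum f {J..r} = sum f {J..i} + sum f {i<..r}" for f :: "nat \<Rightarrow> real"
        by (simp only:, subst sum.union_disjoint) auto
      moreover have "{J..i} = insert i {J..<i}" using True by auto
      ultimately have sp: "sum f {J..r} = sum f {J..<i} + f i + sum f {i<..r}" for f :: "nat \<Rightarrow> real"
        by simp
      have "sum c {J..<i} = (\<Sum>j\<in>{J..<i}. 2 - real (k j))"
        by (intro sum.cong) (auto simp: c_def e_def)
      moreover have "sum c {i<..r} = (\<Sum>j\<in>{i<..r}. 1 - real (k j) + d)"
        by (intro sum.cong) (auto simp: c_def e_def)
      ultimately have "sum c {J..r} = tail_exponent r k J + d * real r - Re s"
        unfolding tail_exponent_def sp using True i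
        by (simp add: c_def sum.distrib sum_subtractf of_nat_diff algebra_simps)
      then show ?thesis using tail[OF J] by simp
    qed
  qed
  finally show ?thesis
    using K0 by (simp add: mult_left_mono K_def)
qed

section \<open>The lower bound\<close>

text \<open>
  The tuple \<open>1, \<dots>, J - 1, m - (r - J), \<dots>, m - 1, m\<close>: the first entries are as small as possible,
  the others as close to the last entry \<open>m\<close> as possible.
\<close>
definition split_tuple :: "nat \<Rightarrow> nat \<Rightarrow> nat \<Rightarrow> nat \<Rightarrow> nat" where
  "split_tuple r J m = restrict (\<lambda>j. if j < J then j else m - (r - j)) {1..r}"

lemma split_tuple_increasing: "r \<le> m \<Longrightarrow> split_tuple r J m \<in> increasing_tuples r"
  by (auto simp: split_tuple_def increasing_tuples_def strict_mono_on_def)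

text \<open>
  A bounded entry \<open>j < J\<close> contributes a factor of order \<open>1 / m\<close>, an entry near \<open>m\<close> one of order
  \<open>m powr (1 - k\<^sub>j)\<close>. Both are at least \<open>r powr (-k\<^sub>j)\<close> times that power: for the former because
  \<open>j \<le> r\<close>, for the latter because its distance to \<open>m\<close> is at most \<open>r\<close>.
\<close>
lemma norm_series_term_split_tuple_ge:
  assumes idx: "is_index r k" and J: "J \<in> {1..r}" and m: "r \<le> m"
  shows "(\<Prod>j\<in>{1..<r}. real r powr - real (k j)) * real m powr (tail_exponent r k J - 1 - Re s) \<le>
    norm (series_term r k s r (split_tuple r J m))"
proof -
  define n where "n = split_tuple r J m"
  define e where "e = (\<lambda>j. if j < J then -1 else 1 - real (k j))"
  have n: "n \<in> increasing_tuples r"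
    using split_tuple_increasing[OF m] by (simp add: n_def)
  have r: "1 \<le> r" using J by simp
  have nr: "n r = m" using J by (auto simp: n_def split_tuple_def)
  have factor: "real r powr - real (k j) * real m powr e j \<le>
      real (n j) powr (1 - real (k j)) / \<bar>real (n j) - real m\<bar>" if j: "j \<in> {1..<r}" for j
  proof -
    have k1: "1 \<le> k j" using idx j by (auto simp: is_index_def)
    have nj: "0 < n j" "n j < m"
      using increasing_tuples_pos[OF n, of j] increasing_tuples_less[OF n, of j r] j nr by auto
    show ?thesis
    proof (cases "j < J")
      case True
      have "real r powr - real (k j) \<le> real r powr (1 - real (k j))"
        using r by (intro powr_mono) auto
      also have "\<dots> \<le> real (n j) powr (1 - real (k j))"
        using True j k1 by (intro powr_mono2') (auto simp: n_def split_tuple_def)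
      finally have "real r powr - real (k j) * (1 / real m) \<le>
          real (n j) powr (1 - real (k j)) * (1 / \<bar>real (n j) - real m\<bar>)"
        using nj by (intro mult_mono frac_le) auto
      then show ?thesis using True nj by (simp add: e_def powr_minus_divide)
    next
      case False
      have diff: "\<bar>real (n j) - real m\<bar> = real (r - j)"
        using False j m by (auto simp: n_def split_tuple_def of_nat_diff)
      have "real r powr - real (k j) \<le> real r powr -1"
        using r k1 by (intro powr_mono) auto
      also have "\<dots> \<le> 1 / \<bar>real (n j) - real m\<bar>"
        unfolding diff using j by (auto simp: powr_minus_divide intro!: frac_le)
      finally have "real r powr - real (k j) * real m powr (1 - real (k j)) \<le>
          (1 / \<bar>real (n j) - real m\<bar>) * real (n j) powr (1 - real (k j))"
        using nj k1 by (intro mult_mono powr_mono2') auto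
      then show ?thesis using False by (simp add: e_def)
    qed
  qed
  have "{J..r} = insert r {J..<r}" using J by auto
  then have sumJ: "sum f {J..r} = f r + sum f {J..<r}" for f :: "nat \<Rightarrow> real" by simp
  have "{1..<r} = {1..<J} \<union> {J..<r}" using J by auto
  then have "sum e {1..<r} = sum e {1..<J} + sum e {J..<r}"
    by (simp add: sum.union_disjoint)
  also have "sum e {1..<J} = (\<Sum>j\<in>{1..<J}. -1)"
    by (intro sum.cong) (auto simp: e_def)
  also have "sum e {J..<r} = (\<Sum>j\<in>{J..<r}. 1 - real (k j))"
    by (intro sum.cong) (auto simp: e_def)
  finally have exponent: "tail_exponent r k J - 1 - Re s = - real (k r) - Re s + sum e {1..<r}"
    unfolding tail_exponent_def sumJ using J by (simp add: sum_subtractf of_nat_diff)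
  have "(\<Prod>j\<in>{1..<r}. real r powr - real (k j)) * real m powr (tail_exponent r k J - 1 - Re s) =
      real m powr (- real (k r) - Re s) * (\<Prod>j\<in>{1..<r}. real r powr - real (k j) * real m powr e j)"
    unfolding exponent powr_add using r m by (simp add: powr_sum prod.distrib)
  also have "\<dots> \<le> real m powr (- real (k r) - Re s) *
      (\<Prod>j\<in>{1..<r}. real (n j) powr (1 - real (k j)) / \<bar>real (n j) - real m\<bar>)"
    using factor by (intro mult_left_mono prod_mono) auto
  also have "\<dots> = norm (series_term r k s r n)"
  proof -
    have "{1..r} - {r} = {1..<r}" by auto
    then show ?thesis using norm_series_term[OF n, of r k s] r nr by simp
  qed
  finally show ?thesis by (simp add: n_def)
qed

text \<open>Otherwise the subseries over the split tuples dominates a multiple of the harmonic series.\<close>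
lemma tail_exponent_less_if_summable:
  assumes idx: "is_index r k" and J: "J \<in> {1..r}"
    and summ: "(\<lambda>n. norm (series_term r k s r n)) summable_on increasing_tuples r"
  shows "tail_exponent r k J < Re s"
proof (rule ccontr)
  assume "\<not> tail_exponent r k J < Re s"
  then have ge: "-1 \<le> tail_exponent r k J - 1 - Re s" by simp
  define C where "C = (\<Prod>j\<in>{1..<r}. real r powr - real (k j))"
  have C: "0 < C" using J by (auto simp: C_def intro!: prod_pos)
  have inj: "inj_on (split_tuple r J) {r..}"
  proof (rule inj_onI)
    fix x y assume "split_tuple r J x = split_tuple r J y"
    then have "split_tuple r J x r = split_tuple r J y r" by simp
    then show "x = y" using J by (simp add: split_tuple_def)
  qed
  have "(\<lambda>n. norm (series_term r k s r n)) summable_on split_tuple r J ` {r..}"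
    using summ by (rule summable_on_subset_banach) (auto intro: split_tuple_increasing)
  then have "(\<lambda>m. norm (series_term r k s r (split_tuple r J m))) summable_on {r..}"
    using summable_on_reindex[OF inj, of "\<lambda>n. norm (series_term r k s r n)"] by (simp add: o_def)
  then have "(\<lambda>m. C * real m powr -1) summable_on {r..}"
  proof (rule summable_on_comparison_test)
    fix m assume m: "m \<in> {r..}"
    have "C * real m powr -1 \<le> C * real m powr (tail_exponent r k J - 1 - Re s)"
      using C m J ge by (intro mult_left_mono powr_mono) auto
    also have "\<dots> \<le> norm (series_term r k s r (split_tuple r J m))"
      unfolding C_def using norm_series_term_split_tuple_ge[OF idx J] m by simp
    finally show "C * real m powr -1 \<le> norm (series_term r k s r (split_tuple r J m))" .
  qed (use C in auto)
  then have "(\<lambda>m. real m powr -1) summable_on {r..}"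
    using C summable_on_cmult_right'[of C "\<lambda>m. real m powr -1" "{r..}"] by blast
  moreover have "(\<lambda>m. real m powr -1) summable_on {..<r}"
    by (rule summable_on_finite) simp
  ultimately have "(\<lambda>m. real m powr -1) summable_on ({r..} \<union> {..<r})"
    by (intro summable_on_Un_disjoint) auto
  moreover have "{r..} \<union> {..<r} = UNIV" by auto
  ultimately have "summable (\<lambda>m. real m powr -1)"
    by (metis summable_on_UNIV_nonneg_real_iff powr_ge_zero)
  then show False unfolding summable_real_powr_iff by simp
qed

section \<open>The criterion for absolute convergence\<close>

theorem theorem1p4:
  fixes r :: nat and k :: "nat \<Rightarrow> nat" and s :: complex
  assumes "admissible r k"
  shows "series_converges_absolutely r k s \<longleftrightarrow>
    real_of_int (Max ((\<lambda>j. int r - 2 * int j + 2 - (\<Sum>l\<in>{j..r}. int (k l))) ` {1..r})) < Re s"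
    (is "_ \<longleftrightarrow> real_of_int (Max (?f ` {1..r})) < _")
proof -
  have idx: "is_index r k" and r: "1 \<le> r"
    using assms by (auto simp: admissible_def is_index_def)
  have f: "real_of_int (?f j) = tail_exponent r k j" for j
    by (simp add: tail_exponent_def)
  define M where "M = Max (?f ` {1..r})"
  have "M \<in> ?f ` {1..r}"
    unfolding M_def using r by (intro Max_in) auto
  then obtain J where J: "J \<in> {1..r}" "M = ?f J" by blast
  have M_ge: "tail_exponent r k j \<le> real_of_int M" if "j \<in> {1..r}" for j
    unfolding f[symmetric] M_def of_int_le_iff using that by (intro Max_ge) auto
  have "series_converges_absolutely r k s \<longleftrightarrow> real_of_int M < Re s"
  proof
    assume "series_converges_absolutely r k s"
    then have "(\<lambda>n. norm (series_term r k s r n)) summable_on increasing_tuples r"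
      using r by (auto simp: series_converges_absolutely_def)
    from tail_exponent_less_if_summable[OF idx J(1) this]
    show "real_of_int M < Re s" unfolding J(2) f .
  next
    assume less: "real_of_int M < Re s"
    \<comment> \<open>At most \<open>r\<close> multiples of \<open>d\<close> accumulate; they must fit both into the gap in the hypothesis
      and into the margin \<open>1\<close> given by admissibility.\<close>
    define d where "d = min 1 (Re s - real_of_int M) / real r"
    have d: "0 < d" "d * real r \<le> 1" "d * real r \<le> Re s - real_of_int M"
      using less r by (auto simp: d_def)
    show "series_converges_absolutely r k s"
      unfolding series_converges_absolutely_def
    proof
      fix i assume i: "i \<in> {1..r}"
      show "(\<lambda>n. norm (series_term r k s i n)) summable_on increasing_tuples r"
      proof (rule summable_on_comparison_test[OF summable_centred_product[OF d(1) i]])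
        fix n assume n: "n \<in> increasing_tuples r"
        show "norm (series_term r k s i n) \<le>
            real (n i) powr (-1 - d) * (\<Prod>j\<in>{1..r} - {i}. kernel d (n i) (n j))"
          using d M_ge
          by (intro norm_series_term_le_centred_product[OF assms i n]) force+
      qed auto
    qed
  qed
  then show ?thesis by (simp add: M_def)
qed

end
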